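(* Let $n\ge 2$, let $\mathbf{i}=\sqrt{-1}$, and for $a\in\mathbb{C}$ let $B_n(a)$ be the $n\times n$ anti-tridiagonal matrix with $(B_n)_{1,n}=(B_n)_{n,1}=a+\mathbf{i}$, $(B_n)_{k,n+1-k}=a$ for $2\le k\le n-1$, all entries $(B_n)_{k,l}$ with $|k+l-(n+1)|=1$ equal to $\mathbf{i}$, and all other entries $0$. Then $$\det(B_n(1))=\begin{cases}(1+2\mathbf{i})F_n, & n\equiv 0\text{ or }1\pmod 4,\\ -(1+2\mathbf{i})F_n, & n\equiv 2\text{ or }3\pmod 4,\end{cases}$$ and $$\det(B_n(2))=\begin{cases}(2+2\mathbf{i})P_n, & n\equiv 0\text{ or }1\pmod 4,\\ -(2+2\mathbf{i})P_n, & n\equiv 2\text{ or }3\pmod 4.\end{cases}$$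
   Context: $F_n$ is the $n$-th Fibonacci number ($F_0=0$, $F_1=1$, $F_n=F_{n-1}+F_{n-2}$) and $P_n$ the $n$-th Pell number ($P_0=0$, $P_1=1$, $P_n=2P_{n-1}+P_{n-2}$). $B_n(a)$ is the anti-tridiagonal matrix of the paper with parameters $a$ and $b=\mathbf{i}$. *)

theory Defs
  imports "Jordan_Normal_Form.Determinant" "HOL-Number_Theory.Fib" "HOL.Complex"
begin

fun pell :: "nat \<Rightarrow> nat" where
  "pell 0 = 0"
| "pell (Suc 0) = 1"
| "pell (Suc (Suc n)) = 2 * pell (Suc n) + pell n"

text \<open>Entries of the \<open>n \<times> n\<close> matrix in terms of the 1-based row and column indices
  \<open>k, l \<in> {1..n}\<close>. The corner condition is tested before the general anti-diagonal one.\<close>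

definition B_entry :: "nat \<Rightarrow> complex \<Rightarrow> nat \<Rightarrow> nat \<Rightarrow> complex" where
  "B_entry n a k l =
    (if (k = 1 \<and> l = n) \<or> (k = n \<and> l = 1) then a + \<i>
     else if k + l = n + 1 then a
     else if \<bar>int k + int l - (int n + 1)\<bar> = 1 then \<i>
     else 0)"

text \<open>Matrices of type \<open>mat\<close> are indexed from 0, hence the shift.\<close>

definition B_mat :: "nat \<Rightarrow> complex \<Rightarrow> complex mat" where
  "B_mat n a = mat n n (\<lambda>(i, j). B_entry n a (i + 1) (j + 1))"

end

theory Submission
  imports Defs
begin

text \<open>
  Expanding along the first row, where only the last two entries are nonzero, lowers the size of the
  matrix by one or two and changes nothing but the entry in the upper right corner, which becomes
  the generic anti-diagonal entry \<open>a\<close>. Up to the sign \<open>(-1)^(n choose 2)\<close> of the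
  order-reversing permutation, the determinants with top corner \<open>a\<close> therefore satisfy
  \<open>E (n+2) = a * E (n+1) - \<i>\<^sup>2 * E n\<close>, the recurrence of Fibonacci (\<open>a = 1\<close>) and
  Pell (\<open>a = 2\<close>) numbers. One more expansion takes care of the modified top corner.
\<close>

text \<open>For \<open>n = 1\<close> the two corners coincide; the lower one \<open>y\<close> takes precedence, which makes
  the recurrence below hold from size 2 onwards.\<close>

definition antitri :: "'a::comm_ring_1 \<Rightarrow> 'a \<Rightarrow> nat \<Rightarrow> 'a \<Rightarrow> 'a \<Rightarrow> 'a mat" where
  "antitri a b n x y = mat n n (\<lambda>(i, j).
     if i + j + 1 = n then (if j = 0 then y else if i = 0 then x else a)
     else if i + j + 2 = n \<or> i + j = n then b
     else 0)"

lemma antitri_carrier [simp]: "antitri a b n x y \<in> carrier_mat n n"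
  by (simp add: antitri_def)

lemma mat_delete_antitri_corner:
  "mat_delete (antitri a b (Suc (Suc n)) x y) 0 (Suc n) = antitri a b (Suc n) a y"
  by (rule eq_matI) (auto simp: antitri_def mat_delete_def)

lemma mat_delete_antitri_twice:
  "mat_delete (mat_delete (antitri a b (Suc (Suc n)) x y) 0 n) 0 n = antitri a b n a y"
  by (rule eq_matI) (auto simp: antitri_def mat_delete_def)

text \<open>The last column that remains is the old column \<open>Suc n\<close>. Below the deleted
  row its only possibly nonzero entry is the topmost \<open>b\<close>, so expansion along it leaves
  one term.\<close>

lemma det_mat_delete_antitri:
  "det (mat_delete (antitri a b (Suc (Suc n)) x y) 0 n) = (-1) ^ n * b * det (antitri a b n a y)"
proof -
  let ?M = "mat_delete (antitri a b (Suc (Suc n)) x y) 0 n"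
  have M: "?M \<in> carrier_mat (Suc n) (Suc n)"
    by (rule mat_delete_carrier[where m = "Suc (Suc n)" and n = "Suc (Suc n)", simplified])
       simp
  have entries: "?M $$ (i, n) = (if i = 0 then b else 0)" if "i < Suc n" for i
    using that by (auto simp: antitri_def mat_delete_def)
  have "det ?M = (\<Sum>i<Suc n. ?M $$ (i, n) * cofactor ?M i n)"
    by (rule laplace_expansion_column[OF M]) simp
  also have "\<dots> = (\<Sum>i<Suc n. if i = 0 then b * cofactor ?M 0 n else 0)"
    by (rule sum.cong) (auto simp: entries)
  also have "\<dots> = b * cofactor ?M 0 n"
    by simp
  finally show ?thesis
    by (simp add: cofactor_def mat_delete_antitri_twice mult_ac)
qed

lemma det_antitri_Suc_Suc:
  "det (antitri a b (Suc (Suc n)) x y) =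
     (-1) ^ Suc n * x * det (antitri a b (Suc n) a y) + b\<^sup>2 * det (antitri a b n a y)"
proof -
  let ?A = "antitri a b (Suc (Suc n)) x y"
  have entries: "?A $$ (0, j) = (if j = n then b else 0)" if "j < Suc n" for j
    using that by (auto simp: antitri_def)
  have corner: "?A $$ (0, Suc n) = x"
    by (simp add: antitri_def)
  have "det ?A = (\<Sum>j<Suc (Suc n). ?A $$ (0, j) * cofactor ?A 0 j)"
    by (rule laplace_expansion_row[OF antitri_carrier]) simp
  also have "\<dots> = (\<Sum>j<Suc n. ?A $$ (0, j) * cofactor ?A 0 j) + x * cofactor ?A 0 (Suc n)"
    by (simp only: sum.lessThan_Suc[of _ "Suc n"] corner)
  also have "(\<Sum>j<Suc n. ?A $$ (0, j) * cofactor ?A 0 j)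
      = (\<Sum>j<Suc n. if j = n then b * cofactor ?A 0 n else 0)"
    by (rule sum.cong) (auto simp: entries)
  also have "\<dots> = b * cofactor ?A 0 n"
    by simp
  also have "\<dots> = ((-1) ^ n * (-1) ^ n) * b\<^sup>2 * det (antitri a b n a y)"
    by (simp add: cofactor_def det_mat_delete_antitri power2_eq_square mult_ac)
  also have "(-1) ^ n * (-1) ^ n = (1::'a)"
    by (simp flip: power_add)
  finally show ?thesis
    by (simp add: cofactor_def mat_delete_antitri_corner mult_ac)
qed

lemma minus_one_power_choose_two_Suc:
  "(-1 :: 'a::comm_ring_1) ^ (Suc n choose 2) = (-1) ^ n * (-1) ^ (n choose 2)"
  by (simp add: numeral_2_eq_2 power_add)

text \<open>The exponent grows by the odd number 2n + 1; this is what turns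
  \<open>+ b\<^sup>2\<close> in the expansion into \<open>- b\<^sup>2\<close> in the recurrence of
  \<open>u\<close>.\<close>

lemma minus_one_power_choose_two_Suc_Suc:
  "(-1 :: 'a::comm_ring_1) ^ (Suc (Suc n) choose 2) = - ((-1) ^ (n choose 2))"
proof -
  have "(-1 :: 'a) ^ n * (-1) ^ n = 1"
    by (simp flip: power_add)
  then show ?thesis
    by (simp add: minus_one_power_choose_two_Suc flip: mult.assoc)
qed

lemma minus_one_power_choose_two:
  "(-1 :: 'a::comm_ring_1) ^ (n choose 2) = (if n mod 4 = 0 \<or> n mod 4 = 1 then 1 else -1)"
proof (induction n rule: nat_induct2)
  case (step n)
  have "(Suc (Suc n) mod 4 = 0 \<or> Suc (Suc n) mod 4 = 1) \<longleftrightarrow> \<not> (n mod 4 = 0 \<or> n mod 4 = 1)"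
    by presburger
  then show ?case
    using step by (simp add: minus_one_power_choose_two_Suc_Suc)
qed (simp_all add: numeral_2_eq_2)

text \<open>With top corner \<open>a\<close> the expansion stays within one family, so the two
  initial values decide: \<open>u (Suc n) + b * u n\<close> starts with 1 and \<open>a + b\<close>,
  as do the determinants of sizes 0 and 1.\<close>

lemma det_antitri_recurrence:
  fixes a b :: "'a::comm_ring_1" and u :: "nat \<Rightarrow> 'a"
  assumes u: "u 0 = 0" "u (Suc 0) = 1" "\<And>n. u (Suc (Suc n)) = a * u (Suc n) - b\<^sup>2 * u n"
  shows "det (antitri a b n a (a + b)) = (-1) ^ (n choose 2) * (u (Suc n) + b * u n)"
proof (induction n rule: induct_nat_012)
  case 0
  then show ?case
    by (simp add: u antitri_def numeral_2_eq_2)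
next
  case 1
  have "antitri a b (Suc 0) a (a + b) $$ (0, 0) = a + b"
    by (simp add: antitri_def)
  then show ?case
    using det_single[of "antitri a b (Suc 0) a (a + b)"] by (simp add: u numeral_2_eq_2)
next
  case (ge2 n)
  \<comment> \<open>Cancels the sign of the corner cofactor against the one released by
    \<open>Suc n choose 2\<close>.\<close>
  have sq: "(-1 :: 'a) ^ n * ((-1) ^ n * z) = z" for z
    by (simp flip: mult.assoc power_add)
  show ?case
    unfolding det_antitri_Suc_Suc ge2.IH minus_one_power_choose_two_Suc
    by (simp add: u algebra_simps power2_eq_square sq)
qed

text \<open>Up to the common sign, the extra \<open>b\<close> in the top corner contributes
  \<open>b\<close> times the value for size n - 1, giving u(n+1) + b u(n) + b (u(n) + b u(n-1)). The
  recurrence replaces u(n+1) + b^2 u(n-1) by a u(n).\<close>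

lemma det_antitri:
  fixes a b :: "'a::comm_ring_1" and u :: "nat \<Rightarrow> 'a"
  assumes u: "u 0 = 0" "u (Suc 0) = 1" "\<And>n. u (Suc (Suc n)) = a * u (Suc n) - b\<^sup>2 * u n"
    and n: "n \<ge> 2"
  shows "det (antitri a b n (a + b) (a + b)) = (-1) ^ (n choose 2) * ((a + 2 * b) * u n)"
proof -
  obtain m where m: "n = Suc (Suc m)"
    using n by (auto simp: numeral_2_eq_2 dest: Suc_le_D)
  have sq: "(-1 :: 'a) ^ m * ((-1) ^ m * z) = z" for z
    by (simp flip: mult.assoc power_add)
  show ?thesis
    unfolding m det_antitri_Suc_Suc det_antitri_recurrence[where u = u, OF u]
      minus_one_power_choose_two_Suc
    by (simp add: u algebra_simps power2_eq_square sq)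
qed

lemma B_mat_eq_antitri: "B_mat n a = antitri a \<i> n (a + \<i>) (a + \<i>)"
  by (rule eq_matI) (auto simp: B_mat_def B_entry_def antitri_def)

text \<open>For \<open>b = \<i>\<close> the coefficient \<open>- b\<^sup>2\<close> is 1, which gives
  the Fibonacci and Pell recurrences for \<open>a = 1\<close> and \<open>a = 2\<close>.\<close>

lemma det_B_mat:
  fixes u :: "nat \<Rightarrow> complex"
  assumes "u 0 = 0" "u (Suc 0) = 1" "\<And>n. u (Suc (Suc n)) = a * u (Suc n) + u n"
    and "n \<ge> 2"
  shows "det (B_mat n a) =
    (if n mod 4 = 0 \<or> n mod 4 = 1 then (a + 2 * \<i>) * u n else - (a + 2 * \<i>) * u n)"
  unfolding B_mat_eq_antitri
  by (subst det_antitri[where u = u]) (use assms in \<open>auto simp: minus_one_power_choose_two algebra_simps\<close>)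

theorem theorem11:
  fixes n :: nat
  assumes "n \<ge> 2"
  shows "det (B_mat n 1) =
           (if n mod 4 = 0 \<or> n mod 4 = 1 then (1 + 2 * \<i>) * of_nat (fib n)
            else - (1 + 2 * \<i>) * of_nat (fib n))
       \<and> det (B_mat n 2) =
           (if n mod 4 = 0 \<or> n mod 4 = 1 then (2 + 2 * \<i>) * of_nat (pell n)
            else - (2 + 2 * \<i>) * of_nat (pell n))"
  by (intro conjI det_B_mat) (use assms in simp_all)

end
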